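(* If Seymour's second neighbourhood conjecture is false (i.e. if there exists at least one counterexample to it), then every orientation $D$ is an induced subgraph of a strongly connected counterexample to Seymour's second neighbourhood conjecture.
   Context: All directed graphs are finite, with non-empty vertex set, and without loops or multiple arcs. An orientation (oriented graph) is a directed graph with no directed cycle of length 2. For a directed graph $G$ and $v\in V(G)$, $N_1(G,v)=\{w : (v,w)\in E(G)\}$ is the out-neighbourhood of $v$, and $N_2(G,v)=\{w\in V(G)\setminus(N_1(G,v)\cup\{v\}) : \exists u\in N_1(G,v),\ (u,w)\in E(G)\}$ is the second out-neighbourhood. Seymour's second neighbourhood conjecture states that every orientation $G$ contains a vertex $v$ with $|N_2(G,v)|\ge |N_1(G,v)|$. A counterexample is an orientation $O$ with $|N_1(O,v)|>|N_2(O,v)|$ for all $v\in V(O)$. A directed graph is strongly connected if for any two vertices $u,v$ there are directed walks from $u$ to $v$ and from $v$ to $u$. "$D$ is an induced subgraph of $O$" means that $D$ is isomorphic to the subdigraph of $O$ induced by some subset of $V(O)$. *)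

theory Defs
  imports "Graph_Theory.Graph_Theory"
begin

text \<open>
  A finite loopless digraph without multiple arcs is a \<^locale>\<open>pair_digraph\<close>, whose arcs are
  ordered pairs of vertices. That locale admits the null graph, so non-emptiness is added here.
\<close>

locale orientation = pair_digraph G for G :: "'a pair_pre_digraph" +
  assumes verts_nonempty: "pverts G \<noteq> {}"
    and no_two_cycles: "(u, v) \<in> parcs G \<Longrightarrow> (v, u) \<notin> parcs G"

definition N1 :: "'a pair_pre_digraph \<Rightarrow> 'a \<Rightarrow> 'a set" where
  "N1 G v = {w. (v, w) \<in> parcs G}"

definition N2 :: "'a pair_pre_digraph \<Rightarrow> 'a \<Rightarrow> 'a set" where
  "N2 G v = {w \<in> pverts G - (N1 G v \<union> {v}). \<exists>u \<in> N1 G v. (u, w) \<in> parcs G}"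

text \<open>
  HOL cannot quantify over types inside a formula, so the conjecture is relative to the type of
  vertices. All infinite types give the same proposition, as every finite digraph has an
  isomorphic copy on any of them.
\<close>

definition seymour_conjecture :: "'a itself \<Rightarrow> bool" where
  "seymour_conjecture _ \<longleftrightarrow>
    (\<forall>G :: 'a pair_pre_digraph. orientation G \<longrightarrow>
      (\<exists>v \<in> pverts G. card (N2 G v) \<ge> card (N1 G v)))"

definition seymour_counterexample :: "'a pair_pre_digraph \<Rightarrow> bool" where
  "seymour_counterexample G \<longleftrightarrow>
    orientation G \<and> (\<forall>v \<in> pverts G. card (N1 G v) > card (N2 G v))"

lemma not_seymour_conjecture_iff:
  "\<not> seymour_conjecture TYPE('a) \<longleftrightarrow> (\<exists>G :: 'a pair_pre_digraph. seymour_counterexample G)"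
  by (auto simp: seymour_conjecture_def seymour_counterexample_def not_le)

text \<open>
  Up to isomorphism, so that \<open>D\<close> and \<open>G\<close> may have different types of vertices.
\<close>

definition is_induced_subgraph :: "'a pair_pre_digraph \<Rightarrow> 'b pair_pre_digraph \<Rightarrow> bool" where
  "is_induced_subgraph D G \<longleftrightarrow>
    (\<exists>W \<subseteq> pverts G. digraph_iso (with_proj D) (with_proj G \<restriction> W))"

end

theory Submission
  imports Defs
begin

text \<open>
  A counterexample \<open>S\<close> with the fewest vertices has no proper nonempty set of vertices closed under
  out-neighbours, since such a set induces a counterexample; so \<open>S\<close> is strongly connected. Replace
  every vertex of \<open>S\<close> by a copy of \<open>D\<close>. At the vertex \<open>(s, d)\<close> of this lexicographic product, the
  excess of \<open>|N\<^sub>1|\<close> over \<open>|N\<^sub>2|\<close> is at least \<open>|D|\<close> from \<open>S\<close>, and \<open>D\<close> itself can spoil at most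
  \<open>|N\<^sub>2(D, d)| < |D|\<close> of it.
\<close>

section \<open>Sets closed under out-neighbours\<close>

text \<open>These are the nonempty sets that no walk leaves. Strong connectivity amounts to the
  whole vertex set being the only one; in this form it follows from minimality and passes to
  products and relabellings without handling walks.\<close>

definition out_closed :: "'a pair_pre_digraph \<Rightarrow> 'a set \<Rightarrow> bool" where
  "out_closed G R \<longleftrightarrow> R \<subseteq> pverts G \<and> R \<noteq> {} \<and> parcs G `` R \<subseteq> R"

text \<open>The vertices reachable from \<open>u\<close> form an out-closed set, which must
  therefore contain every \<open>v\<close>.\<close>

lemma strongly_connected_if_no_proper_out_closed:
  assumes "pair_wf_digraph G" and ne: "pverts G \<noteq> {}"
    and closed: "\<And>R. out_closed G R \<Longrightarrow> R = pverts G"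
  shows "strongly_connected (with_proj G)"
proof (rule strongly_connectedI)
  interpret pair_wf_digraph G by fact
  fix u v assume "u \<in> verts (with_proj G)" and v: "v \<in> verts (with_proj G)"
  then have "u \<in> pverts G" by simp
  have "out_closed G {w. u \<rightarrow>\<^sup>*\<^bsub>with_proj G\<^esub> w}"
    unfolding out_closed_def
  proof (intro conjI subsetI)
    fix w assume "w \<in> parcs G `` {w. u \<rightarrow>\<^sup>*\<^bsub>with_proj G\<^esub> w}"
    then show "w \<in> {w. u \<rightarrow>\<^sup>*\<^bsub>with_proj G\<^esub> w}"
      by (auto intro: reachable_adj_trans)
  next
    show "{w. u \<rightarrow>\<^sup>*\<^bsub>with_proj G\<^esub> w} \<noteq> {}"
      using \<open>u \<in> pverts G\<close> reachable_refl by blast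
  qed (auto dest: reachable_in_verts)
  from closed[OF this] v show "u \<rightarrow>\<^sup>*\<^bsub>with_proj G\<^esub> v" by auto
qed (use ne in simp)

text \<open>The heads of all arcs form an out-closed set, nonempty as soon as there is an arc; hence
  every vertex is a head.\<close>

lemma in_neighbour_if_no_proper_out_closed:
  assumes "pair_wf_digraph G" and "parcs G \<noteq> {}"
    and "\<And>R. out_closed G R \<Longrightarrow> R = pverts G" and "v \<in> pverts G"
  obtains u where "(u, v) \<in> parcs G"
proof -
  interpret pair_wf_digraph G by fact
  have "out_closed G (snd ` parcs G)"
    using assms(2) by (force simp: out_closed_def dest: in_arcsD2)
  then show ?thesis using assms that by fastforce
qed

section \<open>Counterexamples with the fewest vertices\<close>

text \<open>Looplessness is the last assumption at \<open>u = v\<close>, and the arc set is finite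
  as a set of pairs of vertices.\<close>

lemma orientationI:
  assumes "finite (pverts G)" "pverts G \<noteq> {}" "parcs G \<subseteq> pverts G \<times> pverts G"
    and "\<And>u v. (u, v) \<in> parcs G \<Longrightarrow> (v, u) \<notin> parcs G"
  shows "orientation G"
proof unfold_locales
  show "finite (parcs G)"
    using assms by (meson finite_SigmaI finite_subset)
qed (use assms in \<open>fastforce+\<close>)

text \<open>An out-closed \<open>R\<close> contains the first and second out-neighbourhoods of each
  of its vertices, so restricting to \<open>R\<close> changes neither.\<close>

lemma seymour_counterexample_out_closed:
  assumes G: "seymour_counterexample G" and R: "out_closed G R"
  shows "seymour_counterexample \<lparr>pverts = R, parcs = parcs G \<inter> R \<times> R\<rparr>" (is "seymour_counterexample ?H")
proof -
  interpret orientation G using G by (simp add: seymour_counterexample_def)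
  have "orientation ?H"
    using R pair_finite_verts
    by (intro orientationI) (auto simp: out_closed_def dest: no_two_cycles intro: finite_subset)
  moreover have "N1 ?H v = N1 G v" if "v \<in> R" for v
    using that R by (auto simp: N1_def out_closed_def)
  moreover have "N2 ?H v = N2 G v" if "v \<in> R" for v
    using that R by (auto simp: N1_def N2_def out_closed_def subset_iff Image_iff) blast+
  ultimately show ?thesis
    using G R by (auto simp: seymour_counterexample_def out_closed_def)
qed

lemma minimal_seymour_counterexample:
  fixes G :: "'a pair_pre_digraph"
  assumes "seymour_counterexample G"
  obtains S :: "'a pair_pre_digraph"
  where "seymour_counterexample S" "\<And>R. out_closed S R \<Longrightarrow> R = pverts S"
proof -
  obtain S :: "'a pair_pre_digraph" where S: "seymour_counterexample S"
    and min: "\<And>H :: 'a pair_pre_digraph. seymour_counterexample H \<Longrightarrow>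
      card (pverts S) \<le> card (pverts H)"
    using assms ex_has_least_nat[of seymour_counterexample G "\<lambda>H. card (pverts H)"] by blast
  interpret orientation S using S by (simp add: seymour_counterexample_def)
  have "R = pverts S" if R: "out_closed S R" for R
    using min[OF seymour_counterexample_out_closed[OF S R]] R pair_finite_verts
    by (intro card_seteq) (auto simp: out_closed_def)
  with S that show thesis by blast
qed

section \<open>Lexicographic products\<close>

text \<open>Each vertex of \<open>G\<close> is blown up to a copy of \<open>H\<close>, its fibre. An
  arc of \<open>G\<close> puts no condition on \<open>h\<close> and \<open>h'\<close>, so membership
  in the vertex sets is required explicitly.\<close>

definition lex_product ::
    "'a pair_pre_digraph \<Rightarrow> 'b pair_pre_digraph \<Rightarrow> ('a \<times> 'b) pair_pre_digraph" where
  "lex_product G H = \<lparr>pverts = pverts G \<times> pverts H,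
    parcs = {((g, h), (g', h')). g \<in> pverts G \<and> g' \<in> pverts G \<and> h \<in> pverts H \<and> h' \<in> pverts H \<and>
      ((g, g') \<in> parcs G \<or> g = g' \<and> (h, h') \<in> parcs H)}\<rparr>"

text \<open>A 2-cycle of the product would yield a 2-cycle or a loop of \<open>G\<close>, or a
  2-cycle of \<open>H\<close> inside one fibre.\<close>

lemma orientation_lex_product:
  assumes "orientation G" "orientation H"
  shows "orientation (lex_product G H)"
proof -
  interpret G: orientation G by fact
  interpret H: orientation H by fact
  show ?thesis
    by (rule orientationI)
      (auto simp: lex_product_def G.pair_finite_verts H.pair_finite_verts G.verts_nonempty
        H.verts_nonempty dest: G.no_two_cycles H.no_two_cycles G.no_loops')
qed

lemma seymour_counterexample_lex_product:
  assumes G: "seymour_counterexample G" and "orientation H"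
  shows "seymour_counterexample (lex_product G H)"
  unfolding seymour_counterexample_def
proof (intro conjI ballI)
  interpret G: orientation G using G by (simp add: seymour_counterexample_def)
  interpret H: orientation H by fact
  show "orientation (lex_product G H)"
    by (rule orientation_lex_product) unfold_locales
  fix v assume "v \<in> pverts (lex_product G H)"
  then obtain g h where v: "v = (g, h)" and g: "g \<in> pverts G" and h: "h \<in> pverts H"
    by (auto simp: lex_product_def)
  have fin: "finite (N1 G g)" "finite (N2 G g)" "finite (N1 H h)" "finite (N2 H h)"
    using G.pair_finite_verts H.pair_finite_verts
    by (auto simp: N1_def N2_def intro: finite_subset dest: G.in_arcsD2 H.in_arcsD2)
  have sub1: "N1 G g \<times> pverts H \<union> {g} \<times> N1 H h \<subseteq> N1 (lex_product G H) v"
    using g h by (auto simp: v N1_def lex_product_def dest: G.in_arcsD2 H.in_arcsD2)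
  have fin1: "finite (N1 (lex_product G H) v)"
    by (rule finite_subset[of _ "pverts G \<times> pverts H"])
      (auto simp: N1_def lex_product_def G.pair_finite_verts H.pair_finite_verts)
  \<comment> \<open>A walk of length two using one arc between fibres and one inside a fibre ends in
    \<open>N1\<close> of \<open>v\<close>. Two arcs between fibres cannot return to the fibre over
    \<open>g\<close>, as \<open>G\<close> has no 2-cycle. Two arcs inside the fibre give
    \<open>N2 H h\<close>.\<close>
  have sub2: "N2 (lex_product G H) v \<subseteq> N2 G g \<times> pverts H \<union> {g} \<times> N2 H h"
    using g h by (auto simp: v N1_def N2_def lex_product_def dest: G.no_two_cycles)
  \<comment> \<open>The inequality is strict because \<open>h\<close> itself lies outside
    \<open>N2 H h\<close>.\<close>
  have "card (N2 H h) < card (pverts H)"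
    using h H.pair_finite_verts by (intro psubset_card_mono) (auto simp: N2_def)
  have "card (N2 (lex_product G H) v) \<le> card (N2 G g \<times> pverts H \<union> {g} \<times> N2 H h)"
    using sub2 fin H.pair_finite_verts by (intro card_mono) auto
  also have "\<dots> \<le> card (N2 G g) * card (pverts H) + card (N2 H h)"
    using card_Un_le[of "N2 G g \<times> pverts H" "{g} \<times> N2 H h"]
    by (simp add: card_cartesian_product)
  also have "\<dots> < card (N2 G g) * card (pverts H) + card (pverts H)"
    using \<open>card (N2 H h) < card (pverts H)\<close> by simp
  also have "\<dots> = Suc (card (N2 G g)) * card (pverts H)"
    by simp
  \<comment> \<open>The strict inequality at \<open>g\<close> in \<open>G\<close> supplies the
    \<open>Suc\<close>: one spare copy of \<open>H\<close> absorbs the contribution of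
    \<open>N2 H h\<close>.\<close>
  also have "\<dots> \<le> card (N1 G g) * card (pverts H)"
    using G g by (intro mult_right_mono) (auto simp: seymour_counterexample_def Suc_le_eq)
  also have "\<dots> \<le> card (N1 (lex_product G H) v)"
    using card_mono[OF fin1, of "N1 G g \<times> pverts H"] sub1 by (simp add: card_cartesian_product)
  finally show "card (N2 (lex_product G H) v) < card (N1 (lex_product G H) v)" .
qed

text \<open>The projection of \<open>R\<close> to \<open>G\<close> is out-closed, so
  \<open>R\<close> meets every fibre. Every fibre is also entered by an arc of \<open>G\<close>, and
  such an arc leads from a single vertex of \<open>R\<close> to the entire fibre, whatever the arcs
  of \<open>H\<close>.\<close>

lemma lex_product_no_proper_out_closed:
  assumes "pair_wf_digraph G" and "parcs G \<noteq> {}"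
    and closed: "\<And>R. out_closed G R \<Longrightarrow> R = pverts G"
    and R: "out_closed (lex_product G H) R"
  shows "R = pverts (lex_product G H)"
proof
  interpret G: pair_wf_digraph G by fact
  show "R \<subseteq> pverts (lex_product G H)" using R by (simp add: out_closed_def)
  have step: "(g', h') \<in> R" if "(g, h) \<in> R" "(g, g') \<in> parcs G" "h' \<in> pverts H" for g h g' h'
  proof -
    have "((g, h), (g', h')) \<in> parcs (lex_product G H)"
      using R that G.in_arcsD1 G.in_arcsD2 by (auto simp: out_closed_def lex_product_def)
    with R that(1) show ?thesis unfolding out_closed_def by blast
  qed
  have "out_closed G (fst ` R)"
    unfolding out_closed_def
  proof (intro conjI subsetI)
    fix g' assume "g' \<in> parcs G `` fst ` R"
    then obtain g h where "(g, h) \<in> R" "(g, g') \<in> parcs G" by auto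
    moreover from this have "h \<in> pverts H"
      using R by (auto simp: out_closed_def lex_product_def)
    ultimately show "g' \<in> fst ` R" using step by force
  qed (use R in \<open>auto simp: out_closed_def lex_product_def\<close>)
  then have proj: "fst ` R = pverts G" by (rule closed)
  show "pverts (lex_product G H) \<subseteq> R"
  proof
    fix x assume "x \<in> pverts (lex_product G H)"
    then obtain g h where x: "x = (g, h)" "g \<in> pverts G" "h \<in> pverts H"
      by (auto simp: lex_product_def)
    obtain u where u: "(u, g) \<in> parcs G"
      using in_neighbour_if_no_proper_out_closed[OF assms(1,2) closed x(2)] by blast
    then have "u \<in> fst ` R" using proj by (auto dest: G.in_arcsD1)
    then obtain h' where "(u, h') \<in> R" by auto
    with step u x show "x \<in> R" by blast
  qed
qed

section \<open>Relabelling vertices\<close>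

text \<open>Serves to move the product from a type of pairs to the natural numbers.\<close>

definition relabel :: "('a \<Rightarrow> 'b) \<Rightarrow> 'a pair_pre_digraph \<Rightarrow> 'b pair_pre_digraph" where
  "relabel f G = \<lparr>pverts = f ` pverts G, parcs = map_prod f f ` parcs G\<rparr>"

text \<open>Preimages of out-closed sets under \<open>f\<close> are out-closed.\<close>

lemma relabel_no_proper_out_closed:
  assumes closed: "\<And>R. out_closed G R \<Longrightarrow> R = pverts G" and "pair_wf_digraph G"
    and R: "out_closed (relabel f G) R"
  shows "R = pverts (relabel f G)"
proof -
  interpret pair_wf_digraph G by fact
  have "out_closed G {v \<in> pverts G. f v \<in> R}"
    using R by (fastforce simp: out_closed_def relabel_def dest: in_arcsD2)
  from closed[OF this] R show ?thesis
    by (auto simp: out_closed_def relabel_def)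
qed

context
  fixes G :: "'a pair_pre_digraph" and f :: "'a \<Rightarrow> 'b"
  assumes wf: "pair_wf_digraph G" and inj: "inj_on f (pverts G)"
begin

interpretation pair_wf_digraph G by (fact wf)

lemma relabel_arc_iff:
  assumes "u \<in> pverts G" "v \<in> pverts G"
  shows "(f u, f v) \<in> parcs (relabel f G) \<longleftrightarrow> (u, v) \<in> parcs G"
proof
  assume "(f u, f v) \<in> parcs (relabel f G)"
  then obtain a b where "f u = f a" "f v = f b" "(a, b) \<in> parcs G"
    by (auto simp: relabel_def)
  with assms show "(u, v) \<in> parcs G"
    by (metis inj_onD[OF inj] in_arcsD1 in_arcsD2)
qed (metis relabel_def map_prod_imageI pair_pre_digraph.select_convs(2))

lemma N1_relabel:
  assumes "v \<in> pverts G"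
  shows "N1 (relabel f G) (f v) = f ` N1 G v"
proof (intro set_eqI iffI)
  fix w assume w: "w \<in> N1 (relabel f G) (f v)"
  then obtain u where "u \<in> pverts G" "w = f u"
    by (auto simp: N1_def relabel_def dest: in_arcsD2)
  with w assms show "w \<in> f ` N1 G v" by (auto simp: N1_def relabel_arc_iff)
next
  fix w assume "w \<in> f ` N1 G v"
  with assms show "w \<in> N1 (relabel f G) (f v)"
    by (auto simp: N1_def relabel_arc_iff in_arcsD2)
qed

lemma N2_relabel:
  assumes "v \<in> pverts G"
  shows "N2 (relabel f G) (f v) = f ` N2 G v"
proof -
  have sub: "N1 G v \<subseteq> pverts G" by (auto simp: N1_def dest: in_arcsD2)
  have "N2 (relabel f G) (f v) =
      {w \<in> f ` pverts G - f ` (N1 G v \<union> {v}). \<exists>u \<in> N1 G v. (f u, w) \<in> parcs (relabel f G)}"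
    by (auto simp: N2_def N1_relabel[OF assms]) (auto simp: relabel_def)
  \<comment> \<open>Injectivity makes \<open>f\<close> commute with set difference, so
    non-neighbours of \<open>v\<close> stay non-neighbours.\<close>
  also have "f ` pverts G - f ` (N1 G v \<union> {v}) = f ` (pverts G - (N1 G v \<union> {v}))"
    using inj sub assms by (intro inj_on_image_set_diff[symmetric]) auto
  also have "{w \<in> f ` (pverts G - (N1 G v \<union> {v})). \<exists>u \<in> N1 G v. (f u, w) \<in> parcs (relabel f G)} =
      f ` N2 G v"
    using sub by (auto simp: N2_def relabel_arc_iff subset_iff intro!: imageI)
  finally show ?thesis .
qed

lemma seymour_counterexample_relabel:
  assumes "seymour_counterexample G"
  shows "seymour_counterexample (relabel f G)"
  unfolding seymour_counterexample_def
proof (intro conjI ballI)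
  interpret orientation G using assms by (simp add: seymour_counterexample_def)
  show "orientation (relabel f G)"
  proof (rule orientationI)
    fix u v assume uv: "(u, v) \<in> parcs (relabel f G)"
    then obtain a b where "u = f a" "v = f b" "(a, b) \<in> parcs G"
      by (auto simp: relabel_def)
    then show "(v, u) \<notin> parcs (relabel f G)"
      by (auto simp: relabel_arc_iff in_arcsD1 in_arcsD2 dest: no_two_cycles)
  qed (auto simp: relabel_def pair_finite_verts verts_nonempty in_arcsD1 in_arcsD2)
  fix w assume "w \<in> pverts (relabel f G)"
  then obtain v where v: "v \<in> pverts G" "w = f v" by (auto simp: relabel_def)
  have "inj_on f (N1 G v)" "inj_on f (N2 G v)"
    by (auto intro!: inj_on_subset[OF inj] simp: N1_def N2_def dest: in_arcsD2)
  then show "card (N2 (relabel f G) w) < card (N1 (relabel f G) w)"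
    using assms v by (simp add: N1_relabel N2_relabel card_image seymour_counterexample_def)
qed

end

section \<open>Induced copies of a digraph\<close>

lemma is_induced_subgraphI:
  assumes "pair_wf_digraph D" "inj_on f (pverts D)" "f ` pverts D \<subseteq> pverts G"
    and arc_iff: "\<And>u v. u \<in> pverts D \<Longrightarrow> v \<in> pverts D \<Longrightarrow>
      (f u, f v) \<in> parcs G \<longleftrightarrow> (u, v) \<in> parcs D"
  shows "is_induced_subgraph D G"
proof -
  interpret D: pair_wf_digraph D by fact
  \<comment> \<open>Arcs are pairs of vertices, so the arc map applies \<open>f\<close> to both
    ends, while head and tail remain the projections.\<close>
  let ?hom = "\<lparr>iso_verts = f, iso_arcs = map_prod f f, iso_head = snd, iso_tail = fst\<rparr>"
  have "inj_on (map_prod f f) (parcs D)"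
    using map_prod_inj_on[OF assms(2,2)]
    by (rule inj_on_subset) (auto dest: D.in_arcsD1 D.in_arcsD2)
  then have "pre_digraph.digraph_isomorphism (with_proj D) ?hom"
    using assms(1,2) by (auto simp: pre_digraph.digraph_isomorphism_def wf_digraph_wp_iff)
  moreover have "map_prod f f ` parcs D =
      {e \<in> parcs G. fst e \<in> f ` pverts D \<and> snd e \<in> f ` pverts D}"
    (is "?L = ?R")
  proof (intro set_eqI iffI)
    fix e assume "e \<in> ?L"
    then show "e \<in> ?R" by (auto simp: arc_iff D.in_arcsD1 D.in_arcsD2)
  next
    fix e assume "e \<in> ?R"
    then obtain u v where "e = (f u, f v)" "u \<in> pverts D" "v \<in> pverts D" "e \<in> parcs G"
      by (cases e) auto
    with arc_iff show "e \<in> ?L" by (metis map_prod_imageI)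
  qed
  then have "with_proj G \<restriction> (f ` pverts D) = app_iso ?hom (with_proj D)"
    by (simp add: app_iso_def induce_subgraph_def)
  ultimately show ?thesis
    using assms(3) by (auto simp: is_induced_subgraph_def digraph_iso_def)
qed

section \<open>Embedding an orientation in a strongly connected counterexample\<close>

theorem theorem1p2:
  fixes D :: "'a pair_pre_digraph"
  assumes "\<not> seymour_conjecture TYPE('c)"
    and "orientation D"
  shows "\<exists>G :: nat pair_pre_digraph.
    seymour_counterexample G \<and> strongly_connected (with_proj G) \<and> is_induced_subgraph D G"
proof -
  interpret D: orientation D by fact
  obtain S :: "'c pair_pre_digraph" where S: "seymour_counterexample S"
    and closed: "\<And>R. out_closed S R \<Longrightarrow> R = pverts S"
    using assms(1) minimal_seymour_counterexample unfolding not_seymour_conjecture_iff by metis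
  interpret S: orientation S using S by (simp add: seymour_counterexample_def)
  obtain s where s: "s \<in> pverts S" using S.verts_nonempty by blast
  \<comment> \<open>The strict inequality forces \<open>card (N1 S s)\<close> to be positive. The
    resulting arc of \<open>S\<close> is what guarantees in-neighbours in the product
    argument.\<close>
  with S have "N1 S s \<noteq> {}" by (auto simp: seymour_counterexample_def)
  then have arcs: "parcs S \<noteq> {}" by (auto simp: N1_def)
  define P where "P = lex_product S D"
  have P: "seymour_counterexample P"
    unfolding P_def by (rule seymour_counterexample_lex_product[OF S assms(2)])
  interpret P: orientation P using P by (simp add: seymour_counterexample_def)
  obtain f :: "'c \<times> 'a \<Rightarrow> nat" where f: "inj_on f (pverts P)"
    using finite_imp_inj_to_nat_seg[OF P.pair_finite_verts] by blast
  note G = seymour_counterexample_relabel[OF P.pair_wf_digraph f P]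
  interpret G: orientation "relabel f P" using G by (simp add: seymour_counterexample_def)
  have "R = pverts (relabel f P)" if "out_closed (relabel f P) R" for R
    using _ P.pair_wf_digraph that
  proof (rule relabel_no_proper_out_closed)
    show "R = pverts P" if "out_closed P R" for R
      using lex_product_no_proper_out_closed[OF S.pair_wf_digraph arcs closed] that
      unfolding P_def by blast
  qed
  then have "strongly_connected (with_proj (relabel f P))"
    by (intro strongly_connected_if_no_proper_out_closed G.pair_wf_digraph G.verts_nonempty)
  \<comment> \<open>The induced copy of \<open>D\<close> is the fibre over the single vertex
    \<open>s\<close>: as \<open>S\<close> has no loop at \<open>s\<close>, the arcs inside this
    fibre are exactly those of \<open>D\<close>.\<close>
  moreover have "is_induced_subgraph D (relabel f P)"
  proof (rule is_induced_subgraphI[OF D.pair_wf_digraph])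
    have vert: "(s, d) \<in> pverts P" if "d \<in> pverts D" for d
      using s that by (simp add: P_def lex_product_def)
    show "inj_on (\<lambda>d. f (s, d)) (pverts D)"
      using inj_onD[OF f] vert by (auto intro!: inj_onI)
    show "(\<lambda>d. f (s, d)) ` pverts D \<subseteq> pverts (relabel f P)"
      using vert by (auto simp: relabel_def)
    fix u v assume "u \<in> pverts D" "v \<in> pverts D"
    then show "(f (s, u), f (s, v)) \<in> parcs (relabel f P) \<longleftrightarrow> (u, v) \<in> parcs D"
      using s S.no_loops'[of s s]
      by (auto simp: relabel_arc_iff[OF P.pair_wf_digraph f] vert) (auto simp: P_def lex_product_def)
  qed
  ultimately show ?thesis using G by blast
qed

end
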